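(* Let $\mathscr{A}$ be a $C^*$-algebra, let $\mathscr{E}$ be a right Hilbert $\mathscr{A}$-module, and let $\sharp$ be a $*$-conjugate-automorphism of $\mathscr{A}$. Put $\mathscr{A}_{\mathbb{R}}=\{a\in\mathscr{A}:a^\sharp=a\}$. The following assertions are equivalent. (1) $\mathscr{E}$ admits a $\sharp$-conjugation $C$. (2) There exists a real Hilbert $\mathscr{A}_{\mathbb{R}}$-module $\mathscr{F}$ such that the completed complexification $\mathscr{F}\otimes_{\mathbb{R}}\mathbb{C}$ of $\mathscr{F}$ is isometrically isomorphic to $\mathscr{E}$ as a complex Hilbert $\mathscr{A}$-module, where $\mathscr{A}\cong\mathscr{A}_{\mathbb{R}}\otimes_{\mathbb{R}}\mathbb{C}$. (3) There exists a closed real linear subspace $\mathscr{F}\subseteq\mathscr{E}$ such that $\mathscr{F}$ is a right $\mathscr{A}_{\mathbb{R}}$-module, $\langle x,y\rangle\in\mathscr{A}_{\mathbb{R}}$ for all $x,y\in\mathscr{F}$, $\mathscr{F}$ is complete in the inherited norm, and $\mathscr{E}=\mathscr{F}\oplus i\mathscr{F}$ as real vector spaces. Moreover, if a $\sharp$-conjugation $C$ is fixed, then the associated real form is uniquely determined and equals $\mathscr{E}_{\mathbb{R}}=\operatorname{Fix}(C)=\{x\in\mathscr{E}:Cx=x\}$.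
   Context: A $*$-conjugate-automorphism on a $C^*$-algebra $\mathscr{A}$ is a map $\sharp:\mathscr{A}\to\mathscr{A}$, $a\mapsto a^\sharp$, such that for all $a,b\in\mathscr{A}$, $\lambda\in\mathbb{C}$: (1) $(\lambda a+b)^\sharp=\bar\lambda a^\sharp+b^\sharp$; (2) $(a^\sharp)^\sharp=a$; (3) $(a^\sharp)^*=(a^* )^\sharp$; (4) $(ab)^\sharp=a^\sharp b^\sharp$. The fixed-point set $\mathscr{A}_{\mathbb{R}}$ is a real $C^*$-algebra (a closed real $*$-subalgebra of $\mathscr{A}$) and $\mathscr{A}=\mathscr{A}_{\mathbb{R}}\oplus i\mathscr{A}_{\mathbb{R}}\cong\mathscr{A}_{\mathbb{R}}\otimes_{\mathbb{R}}\mathbb{C}$ canonically. Inner products are conjugate-linear in the first and linear in the second variable. A $\sharp$-conjugation on $\mathscr{E}$ is a bounded conjugate-linear operator $C:\mathscr{E}\to\mathscr{E}$ with $C^2=I_{\mathscr{E}}$ and $\langle Cx,Cy\rangle=\langle x,y\rangle^\sharp$ for all $x,y\in\mathscr{E}$. A real Hilbert $\mathscr{A}_{\mathbb{R}}$-module is defined as a Hilbert $C^*$-module, with real scalars and with an inner product valued in the real $C^*$-algebra $\mathscr{A}_{\mathbb{R}}$. The complexification $\mathscr{F}\otimes_{\mathbb{R}}\mathbb{C}$ of such a module carries the $\mathscr{A}_{\mathbb{R}}\otimes_{\mathbb{R}}\mathbb{C}$-module structure $(x\otimes\lambda)(a\otimes\mu)=xa\otimes\lambda\mu$ and the inner product determined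 by $\langle x\otimes\lambda,y\otimes\mu\rangle=\bar\lambda\mu\langle x,y\rangle$. A subspace $\mathscr{F}$ as in (3) is called a real form of $\mathscr{E}$; it is associated with $C$ when $C(x+iy)=x-iy$ for all $x,y\in\mathscr{F}$. *)

theory Defs
  imports "HOL-Analysis.Analysis"
begin

section \<open>Complex normed spaces and C*-algebras\<close>

class complex_vector = real_vector +
  fixes scaleC :: "complex \<Rightarrow> 'a \<Rightarrow> 'a"  (infixr \<open>*\<^sub>C\<close> 75)
  assumes scaleC_add_right: "c *\<^sub>C (x + y) = c *\<^sub>C x + c *\<^sub>C y"
    and scaleC_add_left: "(c + d) *\<^sub>C x = c *\<^sub>C x + d *\<^sub>C x"
    and scaleC_scaleC: "c *\<^sub>C d *\<^sub>C x = (c * d) *\<^sub>C x"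
    and scaleR_scaleC: "r *\<^sub>R x = complex_of_real r *\<^sub>C x"

class complex_normed_vector = complex_vector + real_normed_vector +
  assumes norm_scaleC: "norm (c *\<^sub>C x) = cmod c * norm x"

text \<open>No unit is assumed.\<close>

class cstar_algebra = complex_normed_vector + real_normed_algebra + banach +
  fixes star :: "'a \<Rightarrow> 'a"
  assumes mult_scaleC_left: "(c *\<^sub>C a) * b = c *\<^sub>C (a * b)"
    and mult_scaleC_right: "a * (c *\<^sub>C b) = c *\<^sub>C (a * b)"
    and star_add: "star (a + b) = star a + star b"
    and star_scaleC: "star (c *\<^sub>C a) = cnj c *\<^sub>C star a"
    and star_mult: "star (a * b) = star b * star a"
    and star_star: "star (star a) = a"
    and cstar_identity: "norm (star a * a) = (norm a)\<^sup>2"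

instantiation complex :: cstar_algebra
begin

definition scaleC_complex :: "complex \<Rightarrow> complex \<Rightarrow> complex"
  where "scaleC_complex c x = c * x"

definition star_complex :: "complex \<Rightarrow> complex"
  where "star_complex = cnj"

instance
  by standard
    (auto simp: scaleC_complex_def star_complex_def algebra_simps scaleR_conv_of_real
      norm_mult power2_eq_square)

end

definition cstar_positive :: "'a::cstar_algebra \<Rightarrow> bool"
  where "cstar_positive a \<longleftrightarrow> (\<exists>b. a = star b * b)"

definition star_conj_automorphism :: "('a::cstar_algebra \<Rightarrow> 'a) \<Rightarrow> bool"
  where "star_conj_automorphism sharp \<longleftrightarrow>
    (\<forall>c a b. sharp (c *\<^sub>C a + b) = cnj c *\<^sub>C sharp a + sharp b) \<and>
    (\<forall>a. sharp (sharp a) = a) \<and>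
    (\<forall>a. star (sharp a) = sharp (star a)) \<and>
    (\<forall>a b. sharp (a * b) = sharp a * sharp b)"

definition real_points :: "('a::cstar_algebra \<Rightarrow> 'a) \<Rightarrow> 'a set"
  where "real_points sharp = {a. sharp a = a}"

section \<open>Hilbert modules\<close>

text \<open>
  Right Hilbert modules carried by a whole type, with inner products linear in the second
  variable. Completeness is part of the class \<^class>\<open>banach\<close>, whose norm is tied to the inner
  product by the axiom \<open>norm_eq\<close>; since the right-hand side of \<open>norm_eq\<close> is a norm on every
  inner product module over a C*-algebra, this is no restriction.
\<close>

locale hilbert_module =
  fixes act :: "'e::{complex_normed_vector, banach} \<Rightarrow> 'a::cstar_algebra \<Rightarrow> 'e"
    and ip :: "'e \<Rightarrow> 'e \<Rightarrow> 'a"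
  assumes act_add_left: "act (x + y) a = act x a + act y a"
    and act_add_right: "act x (a + b) = act x a + act x b"
    and act_mult: "act x (a * b) = act (act x a) b"
    and act_scaleC_left: "act (c *\<^sub>C x) a = c *\<^sub>C act x a"
    and act_scaleC_right: "act x (c *\<^sub>C a) = c *\<^sub>C act x a"
    and ip_add_right: "ip x (y + z) = ip x y + ip x z"
    and ip_scaleC_right: "ip x (c *\<^sub>C y) = c *\<^sub>C ip x y"
    and ip_act_right: "ip x (act y a) = ip x y * a"
    and ip_star: "star (ip x y) = ip y x"
    and ip_positive: "cstar_positive (ip x x)"
    and ip_definite: "ip x x = 0 \<Longrightarrow> x = 0"
    and norm_eq: "norm x = sqrt (norm (ip x x))"

text \<open>
  Real Hilbert modules over a real C*-algebra \<open>B\<close> lying inside a complex one, carried by a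
  subspace \<open>F\<close> of an arbitrary real vector space; the operations only matter on the carriers.
  Positivity in \<open>B\<close> is positivity in the surrounding complex C*-algebra. The topology of \<open>F\<close>
  is given by \<open>module_norm\<close> and not by any structure on the type.
\<close>

definition module_norm :: "('f \<Rightarrow> 'f \<Rightarrow> 'a::cstar_algebra) \<Rightarrow> 'f \<Rightarrow> real"
  where "module_norm ip x = sqrt (norm (ip x x))"

locale real_hilbert_module =
  fixes B :: "'a::cstar_algebra set"
    and F :: "'f::real_vector set"
    and act :: "'f \<Rightarrow> 'a \<Rightarrow> 'f"
    and ip :: "'f \<Rightarrow> 'f \<Rightarrow> 'a"
  assumes subspace: "subspace F"
    and act_closed: "\<lbrakk>x \<in> F; a \<in> B\<rbrakk> \<Longrightarrow> act x a \<in> F"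
    and act_add_left: "\<lbrakk>x \<in> F; y \<in> F; a \<in> B\<rbrakk> \<Longrightarrow> act (x + y) a = act x a + act y a"
    and act_add_right: "\<lbrakk>x \<in> F; a \<in> B; b \<in> B\<rbrakk> \<Longrightarrow> act x (a + b) = act x a + act x b"
    and act_mult: "\<lbrakk>x \<in> F; a \<in> B; b \<in> B\<rbrakk> \<Longrightarrow> act x (a * b) = act (act x a) b"
    and act_scaleR_left: "\<lbrakk>x \<in> F; a \<in> B\<rbrakk> \<Longrightarrow> act (r *\<^sub>R x) a = r *\<^sub>R act x a"
    and act_scaleR_right: "\<lbrakk>x \<in> F; a \<in> B\<rbrakk> \<Longrightarrow> act x (r *\<^sub>R a) = r *\<^sub>R act x a"
    and ip_closed: "\<lbrakk>x \<in> F; y \<in> F\<rbrakk> \<Longrightarrow> ip x y \<in> B"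
    and ip_add_right: "\<lbrakk>x \<in> F; y \<in> F; z \<in> F\<rbrakk> \<Longrightarrow> ip x (y + z) = ip x y + ip x z"
    and ip_scaleR_right: "\<lbrakk>x \<in> F; y \<in> F\<rbrakk> \<Longrightarrow> ip x (r *\<^sub>R y) = r *\<^sub>R ip x y"
    and ip_act_right: "\<lbrakk>x \<in> F; y \<in> F; a \<in> B\<rbrakk> \<Longrightarrow> ip x (act y a) = ip x y * a"
    and ip_star: "\<lbrakk>x \<in> F; y \<in> F\<rbrakk> \<Longrightarrow> star (ip x y) = ip y x"
    and ip_positive: "x \<in> F \<Longrightarrow> cstar_positive (ip x x)"
    and ip_definite: "\<lbrakk>x \<in> F; ip x x = 0\<rbrakk> \<Longrightarrow> x = 0"
    and complete: "\<lbrakk>\<And>n. s n \<in> F;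
          \<And>e. e > 0 \<Longrightarrow> \<exists>N. \<forall>m\<ge>N. \<forall>n\<ge>N. module_norm ip (s m - s n) < e\<rbrakk> \<Longrightarrow>
        \<exists>x\<in>F. (\<lambda>n. module_norm ip (s n - x)) \<longlonglongrightarrow> 0"

section \<open>Complexification\<close>

text \<open>
  \<open>V \<otimes> \<complex>\<close> over the reals, realised as \<open>V \<oplus> i V\<close>: the pair \<open>Cx x y\<close> stands for
  \<open>x \<otimes> 1 + y \<otimes> \<i>\<close>.
\<close>

datatype 'f complexification = Cx (cx_re: 'f) (cx_im: 'f)

instantiation complexification :: (real_vector) complex_vector
begin

definition "0 = Cx 0 0"
definition "z + w = Cx (cx_re z + cx_re w) (cx_im z + cx_im w)"
definition "z - w = Cx (cx_re z - cx_re w) (cx_im z - cx_im w)"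
definition "- z = Cx (- cx_re z) (- cx_im z)"
definition "r *\<^sub>R z = Cx (r *\<^sub>R cx_re z) (r *\<^sub>R cx_im z)"
definition "c *\<^sub>C z = Cx (Re c *\<^sub>R cx_re z - Im c *\<^sub>R cx_im z)
                       (Re c *\<^sub>R cx_im z + Im c *\<^sub>R cx_re z)"

instance
  by standard
    (auto simp: zero_complexification_def plus_complexification_def minus_complexification_def
      uminus_complexification_def scaleR_complexification_def scaleC_complexification_def
      algebra_simps)

end

definition cx_tensor :: "'f::real_vector \<Rightarrow> complex \<Rightarrow> 'f complexification"
  where "cx_tensor x c = Cx (Re c *\<^sub>R x) (Im c *\<^sub>R x)"

definition cx_carrier :: "'f set \<Rightarrow> 'f complexification set"
  where "cx_carrier F = {z. cx_re z \<in> F \<and> cx_im z \<in> F}"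

text \<open>
  The identification of \<open>A\<close> with \<open>A\<^sub>\<real> \<otimes> \<complex>\<close>: every \<open>a\<close> is
  \<open>sharp_re sharp a + \<i> *\<^sub>C sharp_im sharp a\<close> with both components fixed by \<open>sharp\<close>.
\<close>

definition sharp_re :: "('a::cstar_algebra \<Rightarrow> 'a) \<Rightarrow> 'a \<Rightarrow> 'a"
  where "sharp_re sharp a = (1 / 2) *\<^sub>C (a + sharp a)"

definition sharp_im :: "('a::cstar_algebra \<Rightarrow> 'a) \<Rightarrow> 'a \<Rightarrow> 'a"
  where "sharp_im sharp a = (1 / (2 * \<i>)) *\<^sub>C (a - sharp a)"

definition cx_act :: "('a::cstar_algebra \<Rightarrow> 'a) \<Rightarrow> ('f::real_vector \<Rightarrow> 'a \<Rightarrow> 'f) \<Rightarrow>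
    'f complexification \<Rightarrow> 'a \<Rightarrow> 'f complexification"
  where "cx_act sharp act z a =
    Cx (act (cx_re z) (sharp_re sharp a) - act (cx_im z) (sharp_im sharp a))
       (act (cx_re z) (sharp_im sharp a) + act (cx_im z) (sharp_re sharp a))"

definition cx_ip :: "('f \<Rightarrow> 'f \<Rightarrow> 'a::cstar_algebra) \<Rightarrow>
    'f complexification \<Rightarrow> 'f complexification \<Rightarrow> 'a"
  where "cx_ip ip z w =
    (ip (cx_re z) (cx_re w) + ip (cx_im z) (cx_im w)) +
    \<i> *\<^sub>C (ip (cx_re z) (cx_im w) - ip (cx_im z) (cx_re w))"

text \<open>The formulas on elementary tensors that determine \<^const>\<open>cx_act\<close> and \<^const>\<open>cx_ip\<close>.\<close>

lemma scaleC_simps: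
  fixes x :: "'a::complex_vector"
  shows "1 *\<^sub>C x = x" "0 *\<^sub>C x = 0" "c *\<^sub>C (0::'a) = 0"
    "(- c) *\<^sub>C x = - (c *\<^sub>C x)" "c *\<^sub>C (- x) = - (c *\<^sub>C x)"
    "c *\<^sub>C (x - y) = c *\<^sub>C x - c *\<^sub>C y"
proof -
  show "1 *\<^sub>C x = x" using scaleR_scaleC[of 1 x] by simp
  show z: "0 *\<^sub>C x = 0" using scaleR_scaleC[of 0 x] by simp
  show z': "c *\<^sub>C (0::'a) = 0" using scaleC_add_right[of c "0::'a" 0] by simp
  show "(- c) *\<^sub>C x = - (c *\<^sub>C x)"
    using scaleC_add_left[of "- c" c x] z by (simp add: eq_neg_iff_add_eq_0)
  show m: "c *\<^sub>C (- x) = - (c *\<^sub>C x)" for x :: 'a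
    using scaleC_add_right[of c "- x" x] z' by (simp add: eq_neg_iff_add_eq_0)
  show "c *\<^sub>C (x - y) = c *\<^sub>C x - c *\<^sub>C y"
    using scaleC_add_right[of c x "- y"] m by simp
qed

lemma star_conj_automorphism_simps:
  assumes "star_conj_automorphism sharp"
  shows "sharp (a + b) = sharp a + sharp b" "sharp (c *\<^sub>C a) = cnj c *\<^sub>C sharp a"
    "sharp (a - b) = sharp a - sharp b" "sharp (sharp a) = a"
proof -
  have lin: "sharp (c *\<^sub>C a + b) = cnj c *\<^sub>C sharp a + sharp b" for c a b
    using assms by (simp add: star_conj_automorphism_def)
  show add: "sharp (a + b) = sharp a + sharp b" for a b
    using lin[of 1 a b] by (simp add: scaleC_simps)
  have zero: "sharp 0 = 0"
    using add[of 0 0] by simp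
  show "sharp (c *\<^sub>C a) = cnj c *\<^sub>C sharp a"
    using lin[of c a 0] zero by simp
  show "sharp (a - b) = sharp a - sharp b"
    using add[of "a - b" b] by (simp add: algebra_simps)
  show "sharp (sharp a) = a"
    using assms by (simp add: star_conj_automorphism_def)
qed

lemma sharp_decomposition:
  assumes "star_conj_automorphism sharp"
  shows "a = sharp_re sharp a + \<i> *\<^sub>C sharp_im sharp a"
    and "sharp_re sharp a \<in> real_points sharp" "sharp_im sharp a \<in> real_points sharp"
proof -
  note S = star_conj_automorphism_simps[OF assms]
  have "sharp_re sharp a + \<i> *\<^sub>C sharp_im sharp a
      = (1 / 2) *\<^sub>C (a + sharp a) + (1 / 2) *\<^sub>C (a - sharp a)"
    by (simp add: sharp_re_def sharp_im_def scaleC_scaleC)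
  also have "\<dots> = (1 / 2) *\<^sub>C a + (1 / 2) *\<^sub>C a"
    by (simp add: scaleC_add_right scaleC_simps(6))
  also have "\<dots> = a"
    by (simp add: scaleC_add_left[symmetric] scaleC_simps)
  finally show "a = sharp_re sharp a + \<i> *\<^sub>C sharp_im sharp a" ..
  show "sharp_re sharp a \<in> real_points sharp"
    by (simp add: real_points_def sharp_re_def S add.commute)
  have "sharp (sharp_im sharp a) = (- (1 / (2 * \<i>))) *\<^sub>C (sharp a - a)"
    by (simp add: sharp_im_def S)
  also have "\<dots> = (1 / (2 * \<i>)) *\<^sub>C (- (sharp a - a))"
    by (simp only: scaleC_simps(4) scaleC_simps(5))
  finally show "sharp_im sharp a \<in> real_points sharp"
    by (simp add: real_points_def sharp_im_def)
qed

lemma sharp_parts_scaleC: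
  assumes "star_conj_automorphism sharp" "a \<in> real_points sharp"
  shows "sharp_re sharp (c *\<^sub>C a) = Re c *\<^sub>R a" "sharp_im sharp (c *\<^sub>C a) = Im c *\<^sub>R a"
proof -
  have sharp: "sharp (c *\<^sub>C a) = cnj c *\<^sub>C a"
    using assms by (simp add: star_conj_automorphism_simps real_points_def)
  have "c *\<^sub>C a + cnj c *\<^sub>C a = (c + cnj c) *\<^sub>C a"
    by (simp add: scaleC_add_left)
  then show "sharp_re sharp (c *\<^sub>C a) = Re c *\<^sub>R a"
    by (simp add: sharp_re_def sharp scaleC_scaleC complex_add_cnj scaleR_scaleC)
  have "c *\<^sub>C a - cnj c *\<^sub>C a = (c - cnj c) *\<^sub>C a"
    using scaleC_add_left[of "c - cnj c" "cnj c" a] by simp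
  moreover have "1 / (2 * \<i>) * (c - cnj c) = complex_of_real (Im c)"
    by (simp add: complex_diff_cnj) (simp add: complex_eq_iff)
  ultimately show "sharp_im sharp (c *\<^sub>C a) = Im c *\<^sub>R a"
    by (simp only: sharp_im_def sharp scaleC_scaleC scaleR_scaleC)
qed

context
  fixes sharp :: "'a::cstar_algebra \<Rightarrow> 'a"
    and F :: "'f::real_vector set" and act ip
  assumes sharp: "star_conj_automorphism sharp"
    and F: "real_hilbert_module (real_points sharp) F act ip"
begin

interpretation real_hilbert_module "real_points sharp" F act ip
  by (rule F)

lemma cx_act_tensor:
  assumes "x \<in> F" "a \<in> real_points sharp"
  shows "cx_act sharp act (cx_tensor x c) (d *\<^sub>C a) = cx_tensor (act x a) (c * d)"
proof -
  have B: "r *\<^sub>R a \<in> real_points sharp" for r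
    using assms(2) sharp
    by (simp add: real_points_def scaleR_scaleC star_conj_automorphism_simps)
  have "act (r *\<^sub>R x) (t *\<^sub>R a) = (r * t) *\<^sub>R act x a" for r t
    using assms B by (simp add: act_scaleR_left act_scaleR_right)
  then show ?thesis
    using assms sharp
    by (simp add: cx_act_def cx_tensor_def sharp_parts_scaleC scaleR_left_diff_distrib
        scaleR_left_distrib)
qed

lemma cx_ip_tensor:
  assumes "x \<in> F" "y \<in> F"
  shows "cx_ip ip (cx_tensor x c) (cx_tensor y d) = (cnj c * d) *\<^sub>C ip x y"
proof -
  have F_scale: "r *\<^sub>R z \<in> F" if "z \<in> F" for r z
    using that subspace by (simp add: subspace_scale)
  have star_scaleR: "star (r *\<^sub>R a) = r *\<^sub>R star a" for r and a :: 'a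
    by (simp add: scaleR_scaleC star_scaleC)
  have "ip (r *\<^sub>R x) y = r *\<^sub>R ip x y" for r
    using assms F_scale
    by (metis ip_scaleR_right ip_star star_scaleR)
  then have ip: "ip (r *\<^sub>R x) (t *\<^sub>R y) = (r * t) *\<^sub>R ip x y" for r t
    using assms F_scale by (simp add: ip_scaleR_right mult.commute)
  have "cx_ip ip (cx_tensor x c) (cx_tensor y d)
      = (Re c * Re d + Im c * Im d) *\<^sub>R ip x y + \<i> *\<^sub>C ((Re c * Im d - Im c * Re d) *\<^sub>R ip x y)"
    by (simp add: cx_ip_def cx_tensor_def ip scaleR_left_diff_distrib scaleR_left_distrib)
  also have "\<dots> = (complex_of_real (Re c * Re d + Im c * Im d)
      + \<i> * complex_of_real (Re c * Im d - Im c * Re d)) *\<^sub>C ip x y"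
    by (simp only: scaleR_scaleC scaleC_scaleC scaleC_add_left)
  also have "complex_of_real (Re c * Re d + Im c * Im d)
      + \<i> * complex_of_real (Re c * Im d - Im c * Re d) = cnj c * d"
    by (simp add: complex_eq_iff)
  finally show ?thesis .
qed

end

section \<open>Completions and isomorphisms\<close>

text \<open>
  The Hilbert module \<open>(actH, ipH)\<close> with the embedding \<open>j\<close> is a completion of the inner product
  module carried by \<open>X\<close>.
\<close>

definition is_completion ::
  "'x::complex_vector set \<Rightarrow> ('x \<Rightarrow> 'a::cstar_algebra \<Rightarrow> 'x) \<Rightarrow> ('x \<Rightarrow> 'x \<Rightarrow> 'a) \<Rightarrow>
   ('h::{complex_normed_vector, banach} \<Rightarrow> 'a \<Rightarrow> 'h) \<Rightarrow> ('h \<Rightarrow> 'h \<Rightarrow> 'a) \<Rightarrow> ('x \<Rightarrow> 'h) \<Rightarrow> bool"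
  where "is_completion X actX ipX actH ipH j \<longleftrightarrow>
    hilbert_module actH ipH \<and>
    (\<forall>x\<in>X. \<forall>y\<in>X. j (x + y) = j x + j y) \<and>
    (\<forall>c. \<forall>x\<in>X. j (c *\<^sub>C x) = c *\<^sub>C j x) \<and>
    (\<forall>x\<in>X. \<forall>a. j (actX x a) = actH (j x) a) \<and>
    (\<forall>x\<in>X. \<forall>y\<in>X. ipH (j x) (j y) = ipX x y) \<and>
    closure (j ` X) = UNIV"

definition hilbert_module_iso ::
  "('h::{complex_normed_vector, banach} \<Rightarrow> 'a::cstar_algebra \<Rightarrow> 'h) \<Rightarrow> ('h \<Rightarrow> 'h \<Rightarrow> 'a) \<Rightarrow>
   ('e::{complex_normed_vector, banach} \<Rightarrow> 'a \<Rightarrow> 'e) \<Rightarrow> ('e \<Rightarrow> 'e \<Rightarrow> 'a) \<Rightarrow> ('h \<Rightarrow> 'e) \<Rightarrow> bool"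
  where "hilbert_module_iso actH ipH actE ipE U \<longleftrightarrow>
    bij U \<and>
    (\<forall>x y. U (x + y) = U x + U y) \<and>
    (\<forall>c x. U (c *\<^sub>C x) = c *\<^sub>C U x) \<and>
    (\<forall>x a. U (actH x a) = actE (U x) a) \<and>
    (\<forall>x y. ipE (U x) (U y) = ipH x y) \<and>
    (\<forall>x. norm (U x) = norm x)"

text \<open>
  There is a real Hilbert module whose completed complexification is isomorphic to the given
  complex Hilbert module. The type arguments name the types in which the real module and the
  completion are sought.
\<close>

definition is_complexified_real_module ::
  "'f::real_vector itself \<Rightarrow> 'h::{complex_normed_vector, banach} itself \<Rightarrow>
   ('a::cstar_algebra \<Rightarrow> 'a) \<Rightarrow>
   ('e::{complex_normed_vector, banach} \<Rightarrow> 'a \<Rightarrow> 'e) \<Rightarrow> ('e \<Rightarrow> 'e \<Rightarrow> 'a) \<Rightarrow> bool"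
  where "is_complexified_real_module _ _ sharp act ip \<longleftrightarrow>
    (\<exists>(F :: 'f set) actF ipF. real_hilbert_module (real_points sharp) F actF ipF \<and>
      (\<exists>(actH :: 'h \<Rightarrow> 'a \<Rightarrow> 'h) ipH j U.
        is_completion (cx_carrier F) (cx_act sharp actF) (cx_ip ipF) actH ipH j \<and>
        hilbert_module_iso actH ipH act ip U))"

section \<open>Conjugations and real forms\<close>

definition sharp_conjugation ::
  "('a::cstar_algebra \<Rightarrow> 'a) \<Rightarrow> ('e::{complex_normed_vector, banach} \<Rightarrow> 'e \<Rightarrow> 'a) \<Rightarrow>
   ('e \<Rightarrow> 'e) \<Rightarrow> bool"
  where "sharp_conjugation sharp ip C \<longleftrightarrow>
    bounded_linear C \<and>
    (\<forall>c x. C (c *\<^sub>C x) = cnj c *\<^sub>C C x) \<and>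
    (\<forall>x. C (C x) = x) \<and>
    (\<forall>x y. ip (C x) (C y) = sharp (ip x y))"

definition real_form ::
  "('a::cstar_algebra \<Rightarrow> 'a) \<Rightarrow> ('e::{complex_normed_vector, banach} \<Rightarrow> 'a \<Rightarrow> 'e) \<Rightarrow>
   ('e \<Rightarrow> 'e \<Rightarrow> 'a) \<Rightarrow> 'e set \<Rightarrow> bool"
  where "real_form sharp act ip F \<longleftrightarrow>
    subspace F \<and> closed F \<and>
    (\<forall>x\<in>F. \<forall>a\<in>real_points sharp. act x a \<in> F) \<and>
    (\<forall>x\<in>F. \<forall>y\<in>F. ip x y \<in> real_points sharp) \<and>
    complete F \<and>
    (\<forall>z. \<exists>x\<in>F. \<exists>y\<in>F. z = x + \<i> *\<^sub>C y) \<and>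
    F \<inter> (\<lambda>y. \<i> *\<^sub>C y) ` F = {0}"

definition associated_real_form :: "('e::complex_vector \<Rightarrow> 'e) \<Rightarrow> 'e set \<Rightarrow> bool"
  where "associated_real_form C F \<longleftrightarrow> (\<forall>x\<in>F. \<forall>y\<in>F. C (x + \<i> *\<^sub>C y) = x - \<i> *\<^sub>C y)"

end

theory Submission
  imports Defs
begin

text \<open>
  The main point is that \<open>sharp\<close> is automatically isometric. It carries quasi-inverses of
  \<open>\<lambda>\<^sup>* h\<close> to quasi-inverses of \<open>\<lambda> sharp h\<close>, and the norm of a
  self-adjoint element is its spectral radius, so \<open>sharp\<close> cannot increase the norm of
  \<open>a\<^sup>* a\<close>. Consequently \<open>x + i y\<close> and \<open>x - i y\<close> have the same norm whenever the inner
  products of \<open>x\<close> and \<open>y\<close> are fixed by \<open>sharp\<close>. This makes the conjugation of a real form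
  bounded, and it bounds \<open>x\<close> and \<open>y\<close> by \<open>x + i y\<close>, so that the complexification of a real
  Hilbert module is already complete and the module sits in its completion as a real form.
\<close>

section \<open>Quasi-inverses\<close>

text \<open>In the unitization this says that \<open>1 + s\<close> is a two-sided inverse of \<open>1 - v\<close>.\<close>

definition quasi_inverse :: "'a::real_normed_algebra \<Rightarrow> 'a \<Rightarrow> bool"
  where "quasi_inverse v s \<longleftrightarrow> s = v + v * s \<and> s = v + s * v"

lemma quasi_inverse_norm_le:
  assumes "quasi_inverse v s" "norm v < 1"
  shows "norm s \<le> norm v / (1 - norm v)"
proof -
  have "norm s = norm (v + v * s)"
    using assms(1) by (simp add: quasi_inverse_def)
  also have "\<dots> \<le> norm v + norm v * norm s"
    by (meson norm_triangle_le add_left_mono norm_mult_ineq)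
  finally show ?thesis
    using assms(2) by (simp add: pos_le_divide_eq algebra_simps)
qed

lemma norm_le_quasi_inverse:
  assumes "quasi_inverse v s"
  shows "norm v \<le> norm s + norm v * norm s"
proof -
  have "v = s - v * s"
    using assms by (simp add: quasi_inverse_def eq_diff_eq)
  then have "norm v \<le> norm s + norm (v * s)"
    by (metis norm_triangle_ineq4)
  then show ?thesis
    using norm_mult_ineq[of v s] by linarith
qed

text \<open>The first equation asks for a fixed point of the contraction
  \<open>\<lambda>x. v + v * x\<close>. The fixed point \<open>s\<close> satisfies the second
  equation too, because \<open>v + s * v\<close> is again a fixed point and there is only
  one.\<close>

lemma quasi_inverse_exists:
  fixes v :: "'a::{real_normed_algebra, banach}"
  assumes "norm v < 1"
  obtains s where "quasi_inverse v s"
proof -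
  have "dist (v + v * x) (v + v * y) \<le> norm v * dist x y" for x y
    using norm_mult_ineq[of v "x - y"] by (simp add: dist_norm right_diff_distrib)
  then have "\<exists>!s. v + v * s = s"
    using assms by (intro banach_fix_type[where c = "norm v"]) auto
  then obtain s where s: "v + v * s = s" and uniq: "\<And>t. v + v * t = t \<Longrightarrow> t = s"
    by metis
  have "v + v * (v + s * v) = v + (v + v * s) * v"
    by (simp add: algebra_simps)
  then have "v + s * v = s"
    unfolding s by (rule uniq)
  with s that[of s] show ?thesis
    unfolding quasi_inverse_def by metis
qed

text \<open>Partial fractions in the unitization: \<open>1 / (1 - v^2)\<close> is the mean of
  \<open>1 / (1 - v)\<close> and \<open>1 / (1 + v)\<close>.\<close>

lemma quasi_inverse_square:
  assumes "quasi_inverse v s" "quasi_inverse (- v) t"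
  shows "quasi_inverse (v * v) ((1 / 2) *\<^sub>R (s + t))"
proof -
  have mult: "v * s = s - v" "s * v = s - v" "v * t = - v - t" "t * v = - v - t"
    using assms by (simp_all add: quasi_inverse_def eq_diff_eq eq_neg_iff_add_eq_0 add.commute)
  then have *: "v * (v * s) = s - v - v * v" "s * v * v = s - v - v * v"
    "v * (v * t) = t + v - v * v" "t * v * v = t + v - v * v"
    by (simp_all add: mult left_diff_distrib right_diff_distrib add.commute)
  have "v * v * (s + t) = v * (v * s) + v * (v * t)" "(s + t) * (v * v) = s * v * v + t * v * v"
    by (simp_all add: distrib_left distrib_right mult.assoc)
  then have sum: "v * v * (s + t) = s + t - 2 *\<^sub>R (v * v)" "(s + t) * (v * v) = s + t - 2 *\<^sub>R (v * v)"
    unfolding * scaleR_2 by simp_all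
  have "v * v * ((1 / 2) *\<^sub>R (s + t)) = (1 / 2) *\<^sub>R (s + t) - v * v"
    "((1 / 2) *\<^sub>R (s + t)) * (v * v) = (1 / 2) *\<^sub>R (s + t) - v * v"
    by (simp_all only: mult_scaleR_left mult_scaleR_right sum scaleR_diff_right) simp_all
  then show ?thesis
    by (simp add: quasi_inverse_def)
qed

text \<open>The resolvent identity \<open>(1 + t) - (1 + s) = (1 + s) * (w - v) * (1 + t)\<close>,
  multiplied out so that no unit occurs.\<close>

lemma quasi_inverse_diff:
  assumes "quasi_inverse v s" "quasi_inverse w t"
  shows "t - s = (w - v) + s * (w - v) + (w - v) * t + s * (w - v) * t"
proof -
  have 1: "s * v = s - v" "w * t = t - w"
    using assms unfolding quasi_inverse_def by (metis add_diff_cancel_left')+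
  have "s * (w - v) * t = s * (w * t) - s * v * t"
    by (simp add: algebra_simps)
  also have "\<dots> = v * t - s * w"
    unfolding 1 by (simp add: algebra_simps)
  finally have *: "s * (w - v) * t = v * t - s * w" .
  show ?thesis
    unfolding * by (simp add: 1 left_diff_distrib right_diff_distrib)
qed

text \<open>With \<open>M = 1 + norm s\<close> and \<open>d = norm (w - v)\<close>, the resolvent
  identity gives the bound \<open>M * d * (1 + norm t)\<close>. Replacing \<open>1 + norm t\<close>
  by \<open>M + norm (t - s)\<close> brings the unknown back with a factor at most 1/2, so the left
  side absorbs it.\<close>

lemma quasi_inverse_dist:
  assumes "quasi_inverse v s" "quasi_inverse w t" and "(1 + norm s) * norm (w - v) \<le> 1 / 2"
  shows "norm (t - s) \<le> 2 * (1 + norm s)\<^sup>2 * norm (w - v)"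
proof -
  define M d where "M = 1 + norm s" and "d = norm (w - v)"
  have "norm (t - s) \<le> norm (w - v) + norm (s * (w - v)) + norm ((w - v) * t)
      + norm (s * (w - v) * t)"
    unfolding quasi_inverse_diff[OF assms(1,2)]
    by (intro norm_triangle_le add_right_mono) auto
  also have "\<dots> \<le> d + norm s * d + d * norm t + norm s * d * norm t"
    unfolding d_def
    by (intro add_mono order_refl norm_mult_ineq)
      (meson mult_right_mono norm_ge_zero norm_mult_ineq order_trans)
  also have "\<dots> = M * d * (1 + norm t)"
    by (simp add: M_def algebra_simps)
  also have "\<dots> \<le> M * d * (M + norm (t - s))"
    using norm_triangle_ineq2[of t s] by (intro mult_left_mono) (auto simp: M_def d_def)
  also have "\<dots> = M\<^sup>2 * d + M * d * norm (t - s)"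
    by (simp add: algebra_simps power2_eq_square)
  also have "\<dots> \<le> M\<^sup>2 * d + 1 / 2 * norm (t - s)"
    using assms(3) by (intro add_left_mono mult_right_mono) (auto simp: M_def d_def)
  finally show ?thesis
    by (simp add: M_def d_def)
qed

lemma continuous_on_quasi_inverse:
  fixes u :: "'a::cstar_algebra"
  assumes f: "\<And>z. z \<in> S \<Longrightarrow> quasi_inverse (z *\<^sub>C u) (f z)"
  shows "continuous_on S f"
  unfolding continuous_on_iff
proof (intro ballI allI impI)
  fix z and e :: real
  assume z: "z \<in> S" and e: "e > 0"
  define M U where "M = 1 + norm (f z)" and "U = norm u + 1"
  have M: "M \<ge> 1" and U: "U \<ge> 1"
    by (auto simp: M_def U_def)
  \<comment> \<open>The first entry secures the smallness hypothesis of
    \<open>quasi_inverse_dist\<close>, the second turns its bound into \<open>e\<close>. The summand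
    1 in \<open>U\<close> keeps the denominators positive when \<open>u = 0\<close>.\<close>
  define \<delta> where "\<delta> = min (1 / (2 * M * U)) (e / (2 * M\<^sup>2 * U))"
  show "\<exists>d>0. \<forall>w\<in>S. dist w z < d \<longrightarrow> dist (f w) (f z) < e"
  proof (intro exI conjI ballI impI)
    show "\<delta> > 0"
      using M U e by (simp add: \<delta>_def)
    fix w assume w: "w \<in> S" and "dist w z < \<delta>"
    then have d: "cmod (w - z) < 1 / (2 * M * U)" "cmod (w - z) < e / (2 * M\<^sup>2 * U)"
      by (auto simp: \<delta>_def dist_norm)
    have wz: "w *\<^sub>C u - z *\<^sub>C u = (w - z) *\<^sub>C u"
      using scaleC_add_left[of "w - z" z u] by simp
    have le: "norm (w *\<^sub>C u - z *\<^sub>C u) \<le> cmod (w - z) * U"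
      unfolding wz norm_scaleC U_def by (intro mult_left_mono) auto
    have "M * norm (w *\<^sub>C u - z *\<^sub>C u) \<le> M * (cmod (w - z) * U)"
      using le M by (intro mult_left_mono) auto
    also have "\<dots> \<le> 1 / 2"
      using d(1) M U by (simp add: field_simps)
    finally have "norm (f w - f z) \<le> 2 * M\<^sup>2 * norm (w *\<^sub>C u - z *\<^sub>C u)"
      unfolding M_def by (intro quasi_inverse_dist f z w)
    also have "\<dots> \<le> 2 * M\<^sup>2 * (cmod (w - z) * U)"
      using le by (intro mult_left_mono) auto
    also have "\<dots> < e"
      using d(2) M U by (simp add: field_simps)
    finally show "dist (f w) (f z) < e"
      by (simp add: dist_norm)
  qed
qed

section \<open>Norms of self-adjoint elements from quasi-inverses on the unit disc\<close>

lemma scaleC_square: "(c *\<^sub>C p) * (c *\<^sub>C p) = c\<^sup>2 *\<^sub>C (p * p)" for p :: "'a::cstar_algebra"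
  by (simp add: mult_scaleC_left mult_scaleC_right scaleC_scaleC power2_eq_square)

lemma star_scaleR: "star (r *\<^sub>R a) = r *\<^sub>R star a"
  by (simp add: scaleR_scaleC star_scaleC)

lemma norm_selfadjoint_square:
  assumes "star p = p"
  shows "norm (p * p) = (norm p)\<^sup>2"
  using cstar_identity[of p] assms by simp

text \<open>
  The spectral radius formula by averaging: the quasi-inverse of \<open>v\<^sup>2\<close> is the mean of those of
  \<open>v\<close> and \<open>-v\<close>, so a bound on how much the quasi-inverses of \<open>\<mu> u\<close> and \<open>t \<mu> u\<close>
  (\<open>\<bar>\<mu>\<bar> = 1\<close>, \<open>t < 1\<close>) differ persists for \<open>u\<^sup>2, u\<^sup>4, \<dots>\<close>, while \<open>t\<close> becomes \<open>t\<^sup>2, t\<^sup>4, \<dots>\<close>.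
\<close>

lemma selfadjoint_norm_neq_1:
  fixes u :: "'a::cstar_algebra"
  assumes u: "star u = u" and ex: "\<And>z. cmod z \<le> 1 \<Longrightarrow> \<exists>s. quasi_inverse (z *\<^sub>C u) s"
  shows "norm u \<noteq> 1"
proof
  assume norm_u: "norm u = 1"
  obtain f where f: "\<And>z. z \<in> cball 0 1 \<Longrightarrow> quasi_inverse (z *\<^sub>C u) (f z)"
    using ex by (metis mem_cball_0)
  then have "continuous_on (cball 0 1) f"
    by (rule continuous_on_quasi_inverse)
  then have "uniformly_continuous_on (cball 0 1) f"
    by (intro compact_uniformly_continuous compact_cball)
  then obtain d where d: "d > 0" and
    unif: "\<And>z w. \<lbrakk>z \<in> cball 0 1; w \<in> cball 0 1; dist w z < d\<rbrakk> \<Longrightarrow> dist (f w) (f z) < 1 / 8"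
    unfolding uniformly_continuous_on_def by (metis zero_less_divide_1_iff zero_less_numeral)
  \<comment> \<open>Halving gives \<open>1 - t < d\<close>, so \<open>f\<close> varies by less than
    1/8 between \<open>\<mu>\<close> and \<open>t * \<mu>\<close>; the minimum with 1 keeps
    \<open>t\<close> positive.\<close>
  define t where "t = 1 - min d 1 / 2"
  have t: "0 < t" "t < 1" "1 - t < d"
    using d by (auto simp: t_def min_def)
  define p where "p n = ((\<lambda>x. x * x) ^^ n) u" for n
  have p_Suc: "p (Suc n) = p n * p n" for n
    by (simp add: p_def)
  have p_star: "star (p n) = p n" for n
    by (induction n) (simp_all add: p_Suc star_mult u p_def)
  \<comment> \<open>This is where self-adjointness enters: by the C*-identity, repeated squaring
    does not lower the norm.\<close>
  have p_norm: "norm (p n) = 1" for n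
    by (induction n) (simp_all add: p_Suc norm_selfadjoint_square p_star, simp add: p_def norm_u)
  have close: "\<exists>s s'. quasi_inverse (\<mu> *\<^sub>C p n) s \<and>
      quasi_inverse ((complex_of_real t ^ 2 ^ n * \<mu>) *\<^sub>C p n) s' \<and> norm (s - s') \<le> 1 / 8"
    if "cmod \<mu> = 1" for n and \<mu> :: complex
    using that
  proof (induction n arbitrary: \<mu>)
    case 0
    have "t * \<mu> \<in> cball 0 1" "\<mu> \<in> cball 0 1"
      using 0 t by (auto simp: norm_mult)
    moreover have "dist \<mu> (t * \<mu>) = 1 - t"
    proof -
      have "\<mu> - t * \<mu> = complex_of_real (1 - t) * \<mu>"
        by (simp add: algebra_simps)
      then show ?thesis
        using 0 t by (simp add: dist_norm norm_mult del: of_real_diff)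
    qed
    ultimately show ?case
      using f unif[of "t * \<mu>" \<mu>] t by (force simp: p_def dist_norm)
  next
    case (Suc n)
    \<comment> \<open>The element at stage \<open>Suc n\<close> is the square of
      \<open>\<nu> *\<^sub>C p n\<close>, so the induction hypothesis is applied to both square
      roots \<open>\<nu>\<close> and \<open>- \<nu>\<close> of \<open>\<mu>\<close>, which lie on
      the unit circle.\<close>
    define \<nu> where "\<nu> = csqrt \<mu>"
    have \<nu>: "\<nu>\<^sup>2 = \<mu>"
      by (simp add: \<nu>_def)
    with Suc.prems have "(cmod \<nu>)\<^sup>2 = 1"
      by (simp flip: norm_power)
    then have cmod: "cmod \<nu> = 1" "cmod (- \<nu>) = 1"
      using norm_ge_zero[of \<nu>] unfolding power2_eq_1_iff by auto
    define r where "r = complex_of_real t ^ 2 ^ n"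
    obtain s1 s1' where 1: "quasi_inverse (\<nu> *\<^sub>C p n) s1"
      "quasi_inverse ((r * \<nu>) *\<^sub>C p n) s1'" "norm (s1 - s1') \<le> 1 / 8"
      using Suc.IH[OF cmod(1)] by (auto simp: r_def)
    obtain s2 s2' where 2: "quasi_inverse (- (\<nu> *\<^sub>C p n)) s2"
      "quasi_inverse (- ((r * \<nu>) *\<^sub>C p n)) s2'" "norm (s2 - s2') \<le> 1 / 8"
      using Suc.IH[OF cmod(2)] by (auto simp: r_def scaleC_simps(4))
    have "quasi_inverse (\<mu> *\<^sub>C p (Suc n)) ((1 / 2) *\<^sub>R (s1 + s2))"
      using quasi_inverse_square[OF 1(1) 2(1)] by (simp add: scaleC_square \<nu> p_Suc)
    moreover have "quasi_inverse ((complex_of_real t ^ 2 ^ Suc n * \<mu>) *\<^sub>C p (Suc n)) ((1 / 2) *\<^sub>R (s1' + s2'))"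
      using quasi_inverse_square[OF 1(2) 2(2)]
      by (simp add: scaleC_square \<nu> p_Suc power_mult_distrib r_def mult.commute flip: power_mult)
    moreover have "norm ((1 / 2) *\<^sub>R (s1 + s2) - (1 / 2) *\<^sub>R (s1' + s2')) \<le> 1 / 8"
    proof -
      have "(1 / 2) *\<^sub>R (s1 + s2) - (1 / 2) *\<^sub>R (s1' + s2')
          = (1 / 2) *\<^sub>R ((s1 - s1') + (s2 - s2'))"
        by (simp add: algebra_simps)
      then show ?thesis
        using norm_triangle_ineq[of "s1 - s1'" "s2 - s2'"] 1(3) 2(3) by simp
    qed
    ultimately show ?case
      by blast
  qed
  \<comment> \<open>For this \<open>n\<close> the shrunken element has norm below 1/8 and its
    quasi-inverse norm at most 1/7, so that of \<open>p n\<close> has norm below 1/2. An element of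
    norm 1 only has quasi-inverses of norm at least 1/2.\<close>
  obtain n where n: "t ^ n < 1 / 8"
    using real_arch_pow_inv[of "1 / 8" t] t by auto
  have "t ^ 2 ^ n \<le> t ^ n"
    using t by (intro power_decreasing) (auto intro: less_imp_le)
  with n have small: "t ^ 2 ^ n < 1 / 8"
    by simp
  obtain s s' where s: "quasi_inverse (p n) s"
    "quasi_inverse (complex_of_real (t ^ 2 ^ n) *\<^sub>C p n) s'" "norm (s - s') \<le> 1 / 8"
    using close[of 1 n] by (auto simp: scaleC_simps)
  have norm_tp: "norm (complex_of_real (t ^ 2 ^ n) *\<^sub>C p n) = t ^ 2 ^ n"
    using t by (simp add: norm_scaleC p_norm norm_power del: of_real_power)
  have "norm s' \<le> t ^ 2 ^ n / (1 - t ^ 2 ^ n)"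
    using quasi_inverse_norm_le[OF s(2)] small by (simp add: norm_tp del: of_real_power)
  also have "\<dots> \<le> 1 / 7"
    using small by (simp add: pos_divide_le_eq)
  finally have "norm s < 1 / 2"
    using s(3) norm_triangle_ineq2[of s s'] by simp
  with norm_le_quasi_inverse[OF s(1)] show False
    by (simp add: p_norm)
qed

text \<open>If \<open>norm u\<close> were at least 1, dividing \<open>u\<close> by its norm would
  only shrink the parameter \<open>z\<close> within the disc, and the normalized element would
  contradict \<open>selfadjoint_norm_neq_1\<close>.\<close>

lemma selfadjoint_norm_lt_1:
  fixes u :: "'a::cstar_algebra"
  assumes u: "star u = u" and ex: "\<And>z. cmod z \<le> 1 \<Longrightarrow> \<exists>s. quasi_inverse (z *\<^sub>C u) s"
  shows "norm u < 1"
proof (rule ccontr)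
  assume "\<not> norm u < 1"
  then have ge: "norm u \<ge> 1"
    by simp
  let ?u = "(1 / norm u) *\<^sub>R u"
  have "norm ?u \<noteq> 1"
  proof (rule selfadjoint_norm_neq_1)
    show "star ?u = ?u"
      by (simp add: star_scaleR u)
    fix z assume "cmod z \<le> 1"
    then have "cmod (z * complex_of_real (1 / norm u)) \<le> 1"
      using ge by (simp add: norm_mult norm_divide divide_le_eq)
    from ex[OF this] show "\<exists>s. quasi_inverse (z *\<^sub>C ?u) s"
      by (simp add: scaleR_scaleC scaleC_scaleC)
  qed
  moreover have "norm ?u = 1"
    using ge by auto
  ultimately show False
    by simp
qed

section \<open>Isometry of \<open>sharp\<close>\<close>

lemma sharp_isometric:
  assumes sharp: "star_conj_automorphism sharp"
  shows "norm (sharp a) = norm a"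
proof -
  note S = star_conj_automorphism_simps[OF sharp]
  have S_mult: "sharp (a * b) = sharp a * sharp b" and S_star: "star (sharp a) = sharp (star a)"
    for a b
    using sharp by (auto simp: star_conj_automorphism_def)
  have lt: "norm (sharp h) < 1" if h: "star h = h" "norm h < 1" for h
  proof (rule selfadjoint_norm_lt_1)
    show "star (sharp h) = sharp h"
      by (simp add: S_star h)
    fix z assume "cmod z \<le> 1"
    then have "norm (cnj z *\<^sub>C h) < 1"
      using h(2) mult_mono[of "cmod z" 1 "norm h" "norm h"] by (simp add: norm_scaleC)
    then obtain s where "quasi_inverse (cnj z *\<^sub>C h) s"
      by (rule quasi_inverse_exists)
    then have "quasi_inverse (sharp (cnj z *\<^sub>C h)) (sharp s)"
      unfolding quasi_inverse_def by (metis S(1) S_mult)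
    then show "\<exists>s. quasi_inverse (z *\<^sub>C sharp h) s"
      by (auto simp: S)
  qed
  have selfadjoint: "norm (sharp h) \<le> norm h" if h: "star h = h" for h
  \<comment> \<open>Division by any \<open>c > norm h\<close> moves \<open>h\<close> into the open
    unit ball, where \<open>lt\<close> applies.\<close>
  proof (rule dense_ge)
    fix c assume c: "norm h < c"
    then have "c > 0"
      using norm_ge_zero[of h] by linarith
    have "norm (sharp ((1 / c) *\<^sub>R h)) < 1"
      using c \<open>c > 0\<close> by (intro lt) (simp_all add: star_scaleR h)
    moreover have "sharp ((1 / c) *\<^sub>R h) = (1 / c) *\<^sub>R sharp h"
      by (simp add: scaleR_scaleC S)
    ultimately show "norm (sharp h) \<le> c"
      using \<open>c > 0\<close> by simp
  qed
  have le: "norm (sharp a) \<le> norm a" for a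
  proof -
    have "(norm (sharp a))\<^sup>2 = norm (sharp (star a * a))"
      by (simp add: S_mult S_star flip: cstar_identity)
    also have "\<dots> \<le> norm (star a * a)"
      by (rule selfadjoint) (simp add: star_mult star_star)
    finally show ?thesis
      by (simp add: cstar_identity power_mono_iff)
  qed
  show ?thesis
    \<comment> \<open>As \<open>sharp\<close> is an involution, the bound at \<open>sharp a\<close>
      is the reverse inequality.\<close>
    using le[of a] le[of "sharp a"] by (simp add: S)
qed

section \<open>Real subspaces of a Hilbert module\<close>

lemma scaleC_scaleR: "c *\<^sub>C r *\<^sub>R x = r *\<^sub>R c *\<^sub>C x"
  by (simp add: scaleR_scaleC scaleC_scaleC mult.commute)

lemma bounded_linear_scaleC: "bounded_linear (\<lambda>x::'a::complex_normed_vector. c *\<^sub>C x)"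
  by (rule bounded_linear_intro[where K = "cmod c"])
    (simp_all add: scaleC_add_right scaleC_scaleR norm_scaleC)

text \<open>The two components are those of \<open>scaleC\<close> on
  \<open>complexification\<close>; hence sending \<open>Cx x y\<close> to
  \<open>x + \<i> *\<^sub>C y\<close> is complex linear.\<close>

lemma scaleC_cartesian:
  "c *\<^sub>C (x + \<i> *\<^sub>C y) = (Re c *\<^sub>R x - Im c *\<^sub>R y) + \<i> *\<^sub>C (Re c *\<^sub>R y + Im c *\<^sub>R x)"
proof -
  have "c *\<^sub>C x = complex_of_real (Re c) *\<^sub>C x + (\<i> * complex_of_real (Im c)) *\<^sub>C x"
    by (metis complex_eq scaleC_add_left)
  moreover have "(c * \<i>) *\<^sub>C y = (\<i> * complex_of_real (Re c)) *\<^sub>C y + (- complex_of_real (Im c)) *\<^sub>C y"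
  proof -
    have "c * \<i> = \<i> * complex_of_real (Re c) + - complex_of_real (Im c)"
      by (simp add: complex_eq_iff)
    then show ?thesis
      by (metis scaleC_add_left)
  qed
  ultimately show ?thesis
    by (simp add: scaleR_scaleC scaleC_add_right scaleC_scaleC scaleC_simps(4))
qed

lemma star_zero: "star (0::'a::cstar_algebra) = 0"
  using star_add[of "0::'a" 0] by simp

lemma sharp_scaleR:
  assumes "star_conj_automorphism sharp"
  shows "sharp (r *\<^sub>R a) = r *\<^sub>R sharp a"
  using assms by (simp add: scaleR_scaleC star_conj_automorphism_simps)

lemma sharp_zero:
  assumes "star_conj_automorphism sharp"
  shows "sharp 0 = 0"
  using sharp_scaleR[OF assms, of 0 0] by simp

lemma sharp_parts_real:
  assumes "star_conj_automorphism sharp" "a \<in> real_points sharp"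
  shows "sharp_re sharp a = a" "sharp_im sharp a = 0"
  using sharp_parts_scaleC[OF assms, of 1] by (simp_all add: scaleC_simps)

context hilbert_module
begin

lemma ip_add_left: "ip (x + y) z = ip x z + ip y z"
  by (metis ip_star ip_add_right star_add)

lemma ip_scaleC_left: "ip (c *\<^sub>C x) y = cnj c *\<^sub>C ip x y"
  by (metis ip_star ip_scaleC_right star_scaleC)

lemma ip_diff_right: "ip x (y - z) = ip x y - ip x z"
  using ip_add_right[of x "y - z" z] by simp

lemma ip_minus_right: "ip x (- y) = - ip x y"
  using ip_scaleC_right[of x "- 1" y] by (simp add: scaleC_simps)

lemma ip_minus_left: "ip (- x) y = - ip x y"
  using ip_scaleC_left[of "- 1" x y] by (simp add: scaleC_simps)

lemma ip_ext:
  assumes "\<And>z. ip z x = ip z y"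
  shows "x = y"
  using ip_definite[of "x - y"] assms by (simp add: ip_diff_right)

text \<open>Together with \<open>act_cartesian\<close> this recovers the formulas of
  \<open>cx_ip\<close> and \<open>cx_act\<close> inside a complex module.\<close>

lemma ip_cartesian:
  "ip (x + \<i> *\<^sub>C y) (v + \<i> *\<^sub>C w) = (ip x v + ip y w) + \<i> *\<^sub>C (ip x w - ip y v)"
  by (simp add: ip_add_left ip_add_right ip_scaleC_left ip_scaleC_right scaleC_scaleC
      scaleC_simps scaleC_add_right)

lemma act_cartesian:
  "act (x + \<i> *\<^sub>C y) (a + \<i> *\<^sub>C b) = (act x a - act y b) + \<i> *\<^sub>C (act x b + act y a)"
  by (simp add: act_add_left act_add_right act_scaleC_left act_scaleC_right scaleC_scaleC
      scaleC_simps scaleC_add_right)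

lemma module_norm_eq_norm: "module_norm ip x = norm x"
  by (simp add: module_norm_def norm_eq)

end

text \<open>The setting of the norm estimates, kept small enough to cover the fixed points of a
  conjugation and the image of a real module in its completion before these are known to be real
  forms.\<close>

locale real_valued_subspace = hilbert_module act ip
  for act :: "'e::{complex_normed_vector, banach} \<Rightarrow> 'a::cstar_algebra \<Rightarrow> 'e" and ip +
  fixes sharp :: "'a \<Rightarrow> 'a" and F :: "'e set"
  assumes sharp: "star_conj_automorphism sharp"
    and subspace: "subspace F"
    and ip_real: "\<lbrakk>x \<in> F; y \<in> F\<rbrakk> \<Longrightarrow> ip x y \<in> real_points sharp"
begin

text \<open>In \<open>ip_cartesian\<close>, changing the signs of \<open>y\<close> and
  \<open>w\<close> flips only the term with factor \<open>\<i>\<close>. So does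
  \<open>sharp\<close>, which fixes the four inner products and is conjugate linear.\<close>

lemma ip_conjugate:
  assumes "x \<in> F" "y \<in> F" "v \<in> F" "w \<in> F"
  shows "ip (x - \<i> *\<^sub>C y) (v - \<i> *\<^sub>C w) = sharp (ip (x + \<i> *\<^sub>C y) (v + \<i> *\<^sub>C w))"
proof -
  have real: "sharp (ip p q) = ip p q" if "p \<in> F" "q \<in> F" for p q
    using ip_real[OF that] by (simp add: real_points_def)
  have "x - \<i> *\<^sub>C y = x + \<i> *\<^sub>C (- y)" "v - \<i> *\<^sub>C w = v + \<i> *\<^sub>C (- w)"
    by (simp_all add: scaleC_simps)
  then show ?thesis
    unfolding ip_cartesian
    by (simp only: ip_cartesian)
      (simp add: ip_minus_left ip_minus_right scaleC_simps real assms
        star_conj_automorphism_simps[OF sharp])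
qed

lemma norm_conjugate:
  assumes "x \<in> F" "y \<in> F"
  shows "norm (x - \<i> *\<^sub>C y) = norm (x + \<i> *\<^sub>C y)"
  using ip_conjugate[OF assms assms] by (simp add: norm_eq sharp_isometric[OF sharp])

text \<open>\<open>x\<close> and \<open>\<i> *\<^sub>C y\<close> are half the sum and half the
  difference of two vectors of equal norm.\<close>

lemma norm_parts_le:
  assumes "x \<in> F" "y \<in> F"
  shows "norm x \<le> norm (x + \<i> *\<^sub>C y)" "norm y \<le> norm (x + \<i> *\<^sub>C y)"
proof -
  have "2 *\<^sub>R x = (x + \<i> *\<^sub>C y) + (x - \<i> *\<^sub>C y)"
    by (simp add: scaleR_2)
  then have "2 * norm x \<le> norm (x + \<i> *\<^sub>C y) + norm (x - \<i> *\<^sub>C y)"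
    using norm_triangle_ineq[of "x + \<i> *\<^sub>C y" "x - \<i> *\<^sub>C y"] by (metis norm_scaleR abs_numeral)
  then show "norm x \<le> norm (x + \<i> *\<^sub>C y)"
    using norm_conjugate[OF assms] by simp
  have "2 *\<^sub>R (\<i> *\<^sub>C y) = (x + \<i> *\<^sub>C y) - (x - \<i> *\<^sub>C y)"
    by (simp add: scaleR_2)
  then have "2 * norm (\<i> *\<^sub>C y) \<le> norm (x + \<i> *\<^sub>C y) + norm (x - \<i> *\<^sub>C y)"
    using norm_triangle_ineq4[of "x + \<i> *\<^sub>C y" "x - \<i> *\<^sub>C y"] by (metis norm_scaleR abs_numeral)
  then show "norm y \<le> norm (x + \<i> *\<^sub>C y)"
    using norm_conjugate[OF assms] by (simp add: norm_scaleC)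
qed

text \<open>The difference of the two decompositions represents 0, whose norm bounds both of its
  parts.\<close>

lemma cartesian_unique:
  assumes "x \<in> F" "y \<in> F" "v \<in> F" "w \<in> F" and "x + \<i> *\<^sub>C y = v + \<i> *\<^sub>C w"
  shows "x = v" "y = w"
proof -
  have "(x - v) + \<i> *\<^sub>C (y - w) = 0"
    using assms(5) by (simp add: scaleC_simps algebra_simps)
  moreover have "x - v \<in> F" "y - w \<in> F"
    using assms by (auto intro: subspace_diff[OF subspace])
  ultimately show "x = v" "y = w"
    using norm_parts_le[of "x - v" "y - w"] by auto
qed

text \<open>By \<open>norm_parts_le\<close> the two parts of a convergent sequence are Cauchy
  sequences in \<open>F\<close>, and their limits there decompose the limit. This later upgrades a
  dense sum to the whole space.\<close>

lemma closed_cartesian: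
  assumes "complete F"
  shows "closed {x + \<i> *\<^sub>C y | x y. x \<in> F \<and> y \<in> F}"
proof -
  let ?S = "{x + \<i> *\<^sub>C y | x y. x \<in> F \<and> y \<in> F}"
  have "l \<in> ?S" if S: "\<And>n. s n \<in> ?S" and l: "s \<longlonglongrightarrow> l" for s :: "nat \<Rightarrow> 'e" and l
  proof -
    obtain x y where F: "\<And>n. x n \<in> F" "\<And>n. y n \<in> F" and s: "\<And>n. s n = x n + \<i> *\<^sub>C y n"
      using S by simp metis
    have diff: "s m - s n = (x m - x n) + \<i> *\<^sub>C (y m - y n)" for m n
      by (simp add: s scaleC_simps)
    have "x m - x n \<in> F" "y m - y n \<in> F" for m n
      using F by (auto intro: subspace_diff[OF subspace])
    then have le: "dist (x m) (x n) \<le> dist (s m) (s n)" "dist (y m) (y n) \<le> dist (s m) (s n)" for m n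
      unfolding dist_norm diff by (auto intro: norm_parts_le)
    have "Cauchy s"
      using l by (rule LIMSEQ_imp_Cauchy)
    then have "Cauchy x" "Cauchy y"
      unfolding Cauchy_def by (meson le le_less_trans)+
    then obtain x' y' where lim: "x' \<in> F" "x \<longlonglongrightarrow> x'" "y' \<in> F" "y \<longlonglongrightarrow> y'"
      using assms F unfolding complete_def by metis
    have "s \<longlonglongrightarrow> x' + \<i> *\<^sub>C y'"
      unfolding s[abs_def] by (intro tendsto_add lim bounded_linear.tendsto[OF bounded_linear_scaleC])
    then have "l = x' + \<i> *\<^sub>C y'"
      using l LIMSEQ_unique by blast
    then show ?thesis
      using lim by auto
  qed
  then show ?thesis
    unfolding closed_sequential_limits by blast
qed

text \<open>Completeness implies closedness, and \<open>x = \<i> *\<^sub>C y\<close> gives two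
  decompositions of one vector, so the sum is direct.\<close>

lemma real_formI:
  assumes act: "\<And>x a. \<lbrakk>x \<in> F; a \<in> real_points sharp\<rbrakk> \<Longrightarrow> act x a \<in> F"
    and "complete F"
    and span: "\<And>z. \<exists>x\<in>F. \<exists>y\<in>F. z = x + \<i> *\<^sub>C y"
  shows "real_form sharp act ip F"
proof -
  have "x = 0" if x: "x \<in> F" and y: "y \<in> F" and "x = \<i> *\<^sub>C y" for x y
    using cartesian_unique(1)[of x 0 0 y] that subspace_0[OF subspace] by (simp add: scaleC_simps)
  then have "F \<inter> (\<lambda>y. \<i> *\<^sub>C y) ` F \<subseteq> {0}"
    by auto
  moreover have "0 \<in> F \<inter> (\<lambda>y. \<i> *\<^sub>C y) ` F"
    using subspace_0[OF subspace] by (auto simp: scaleC_simps intro!: image_eqI[of _ _ 0])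
  ultimately show ?thesis
    unfolding real_form_def
    using assms subspace ip_real complete_imp_closed by blast
qed

end

section \<open>Conjugations and real forms\<close>

context hilbert_module
begin

lemma real_form_real_valued_subspace:
  assumes "star_conj_automorphism sharp" "real_form sharp act ip F"
  shows "real_valued_subspace act ip sharp F"
  using assms hilbert_module_axioms
  by (auto simp: real_form_def real_valued_subspace_def real_valued_subspace_axioms_def)

text \<open>Compatibility with the action is forced by the inner product: tested against
  \<open>z = C (C z)\<close>, both sides agree because \<open>sharp\<close> is multiplicative, and
  such tests separate vectors.\<close>

lemma sharp_conjugation_act:
  assumes sharp: "star_conj_automorphism sharp" and C: "sharp_conjugation sharp ip C"
  shows "C (act x a) = act (C x) (sharp a)"
proof (rule ip_ext)
  fix z
  have CC: "C (C y) = y" and ip_C: "ip (C y) (C w) = sharp (ip y w)" for y w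
    using C by (auto simp: sharp_conjugation_def)
  have mult: "sharp (a * b) = sharp a * sharp b" for a b
    using sharp by (simp add: star_conj_automorphism_def)
  have "ip (C (C z)) (C (act x a)) = ip (C (C z)) (C x) * sharp a"
    by (simp only: ip_C ip_act_right mult)
  then show "ip z (C (act x a)) = ip z (act (C x) (sharp a))"
    by (simp add: CC ip_act_right)
qed

lemma real_form_Fix:
  assumes sharp: "star_conj_automorphism sharp" and C: "sharp_conjugation sharp ip C"
  shows "real_form sharp act ip {x. C x = x}" "associated_real_form C {x. C x = x}"
proof -
  have "bounded_linear C" and scale: "\<And>c x. C (c *\<^sub>C x) = cnj c *\<^sub>C C x"
    and CC: "\<And>x. C (C x) = x" and ip_C: "\<And>x y. ip (C x) (C y) = sharp (ip x y)"
    using C by (auto simp: sharp_conjugation_def)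
  then interpret C: bounded_linear C
    by simp
  show "associated_real_form C {x. C x = x}"
    by (simp add: associated_real_form_def C.add scale scaleC_simps)
  interpret real_valued_subspace act ip sharp "{x. C x = x}"
  proof unfold_locales
    show "star_conj_automorphism sharp"
      by (rule sharp)
    show "subspace {x. C x = x}"
      by (auto simp: subspace_def C.zero C.add C.scaleR)
    show "ip x y \<in> real_points sharp" if "x \<in> {x. C x = x}" "y \<in> {x. C x = x}" for x y
      using that ip_C[of x y] by (simp add: real_points_def)
  qed
  show "real_form sharp act ip {x. C x = x}"
  proof (rule real_formI)
    show "act x a \<in> {x. C x = x}" if "x \<in> {x. C x = x}" "a \<in> real_points sharp" for x a
      using that by (simp add: sharp_conjugation_act[OF sharp C] real_points_def)
    have "closed {x. C x = x}"
      by (intro closed_Collect_eq C.continuous_on continuous_on_id)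
    then show "complete {x. C x = x}"
      by (simp add: complete_eq_closed)
    fix z
    \<comment> \<open>Real and imaginary part of \<open>z\<close> relative to \<open>C\<close>, with
      \<open>- \<i>\<close> for \<open>1 / \<i>\<close>. Applying \<open>C\<close> flips both the
      sign of \<open>- \<i>\<close> and that of \<open>z - C z\<close>, so \<open>?y\<close> is
      fixed.\<close>
    let ?x = "(1 / 2) *\<^sub>R (z + C z)" and ?y = "(1 / 2) *\<^sub>R ((- \<i>) *\<^sub>C (z - C z))"
    have "C ?y = (1 / 2) *\<^sub>R (\<i> *\<^sub>C (C z - z))"
      by (simp only: C.scaleR scale C.diff CC) simp
    also have "\<dots> = ?y"
      by (simp add: scaleC_simps)
    finally have "?y \<in> {x. C x = x}"
      by simp
    moreover have "?x \<in> {x. C x = x}"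
      by (simp add: C.scaleR C.add CC add.commute)
    moreover have "z = ?x + \<i> *\<^sub>C ?y"
    proof -
      have "\<i> *\<^sub>C ?y = (1 / 2) *\<^sub>R (z - C z)"
        by (simp add: scaleC_scaleR scaleC_scaleC scaleC_simps)
      then have "?x + \<i> *\<^sub>C ?y = (1 / 2) *\<^sub>R (z + z)"
        by (simp add: algebra_simps)
      then show ?thesis
        by (simp flip: scaleR_2)
    qed
    ultimately show "\<exists>x\<in>{x. C x = x}. \<exists>y\<in>{x. C x = x}. z = x + \<i> *\<^sub>C y"
      by blast
  qed
qed

text \<open>Taking \<open>y = 0\<close> shows that \<open>C\<close> fixes \<open>F\<close>.
  Conversely, if \<open>x + \<i> *\<^sub>C y\<close> is fixed, uniqueness of the parts gives
  \<open>y = - y\<close>.\<close>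

lemma associated_real_form_eq_Fix:
  assumes sharp: "star_conj_automorphism sharp" and F: "real_form sharp act ip F"
    and assoc: "associated_real_form C F"
  shows "F = {x. C x = x}"
proof -
  interpret real_valued_subspace act ip sharp F
    by (rule real_form_real_valued_subspace[OF sharp F])
  have C: "C (x + \<i> *\<^sub>C y) = x - \<i> *\<^sub>C y" if "x \<in> F" "y \<in> F" for x y
    using assoc that by (simp add: associated_real_form_def)
  have "C x = x" if "x \<in> F" for x
    using C[OF that subspace_0[OF subspace]] by (simp add: scaleC_simps)
  moreover have "z \<in> F" if z: "C z = z" for z
  proof -
    obtain x y where xy: "x \<in> F" "y \<in> F" "z = x + \<i> *\<^sub>C y"
      using F unfolding real_form_def by meson
    have "x + \<i> *\<^sub>C y = x + \<i> *\<^sub>C (- y)"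
      using z C xy by (simp add: scaleC_simps)
    then have "y = - y"
      using xy by (intro cartesian_unique(2)[of x y x "- y"]) (auto intro: subspace_neg[OF subspace])
    then have "y = 0"
      by (simp add: eq_neg_iff_add_eq_0 flip: scaleR_2)
    then show ?thesis
      using xy by (simp add: scaleC_simps)
  qed
  ultimately show ?thesis
    by blast
qed

lemma real_form_imp_conjugation:
  assumes sharp: "star_conj_automorphism sharp" and F: "real_form sharp act ip F"
  shows "\<exists>C. sharp_conjugation sharp ip C"
proof -
  interpret real_valued_subspace act ip sharp F
    by (rule real_form_real_valued_subspace[OF sharp F])
  have span: "\<exists>x y. x \<in> F \<and> y \<in> F \<and> z = x + \<i> *\<^sub>C y" for z
    using F unfolding real_form_def by meson
  then obtain p q where pq: "\<And>z. p z \<in> F" "\<And>z. q z \<in> F" "\<And>z. z = p z + \<i> *\<^sub>C q z"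
    by metis
  \<comment> \<open>\<open>p\<close> and \<open>q\<close> are choice functions; uniqueness of the
    parts lets \<open>C\<close> be computed from any decomposition at hand.\<close>
  define C where "C z = p z - \<i> *\<^sub>C q z" for z
  have C: "C (x + \<i> *\<^sub>C y) = x - \<i> *\<^sub>C y" if "x \<in> F" "y \<in> F" for x y
    using cartesian_unique[of "p (x + \<i> *\<^sub>C y)" "q (x + \<i> *\<^sub>C y)" x y] pq that
    unfolding C_def by metis
  note mem = subspace_add[OF subspace] subspace_diff[OF subspace] subspace_neg[OF subspace]
    subspace_scale[OF subspace]
  have add: "C (z + w) = C z + C w" for z w
  proof -
    obtain x y v w' where *: "x \<in> F" "y \<in> F" "z = x + \<i> *\<^sub>C y" "v \<in> F" "w' \<in> F" "w = v + \<i> *\<^sub>C w'"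
      using span by metis
    have "z + w = (x + v) + \<i> *\<^sub>C (y + w')"
      by (simp add: * scaleC_add_right)
    then have "C (z + w) = (x + v) - \<i> *\<^sub>C (y + w')"
      using * by (simp only: C mem)
    also have "\<dots> = C z + C w"
      using * by (simp add: C scaleC_add_right)
    finally show ?thesis .
  qed
  have scale: "C (c *\<^sub>C z) = cnj c *\<^sub>C C z" for c z
  proof -
    obtain x y where *: "x \<in> F" "y \<in> F" "z = x + \<i> *\<^sub>C y"
      using span by metis
    have "C (c *\<^sub>C z) = (Re c *\<^sub>R x - Im c *\<^sub>R y) - \<i> *\<^sub>C (Re c *\<^sub>R y + Im c *\<^sub>R x)"
      unfolding *(3) scaleC_cartesian using * by (intro C mem)
    also have "\<dots> = cnj c *\<^sub>C (x + \<i> *\<^sub>C (- y))"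
      unfolding scaleC_cartesian by (simp add: scaleC_simps scaleC_add_right)
    also have "\<dots> = cnj c *\<^sub>C C z"
      using * by (simp add: C scaleC_simps)
    finally show ?thesis .
  qed
  have CC: "C (C z) = z" for z
  proof -
    obtain x y where *: "x \<in> F" "y \<in> F" "z = x + \<i> *\<^sub>C y"
      using span by metis
    then have "C z = x + \<i> *\<^sub>C (- y)"
      by (simp add: C scaleC_simps)
    then show ?thesis
      using * by (simp only: C mem) (simp add: scaleC_simps)
  qed
  have norm_C: "norm (C z) = norm z" for z
    using span[of z] by (auto simp: C norm_conjugate)
  have "bounded_linear C"
    by (rule bounded_linear_intro[where K = 1])
      (simp_all add: add scale norm_C scaleR_scaleC)
  moreover have "ip (C z) (C w) = sharp (ip z w)" for z w
    using span[of z] span[of w] by (auto simp: C ip_conjugate)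
  ultimately have "sharp_conjugation sharp ip C"
    using scale CC by (simp add: sharp_conjugation_def)
  then show ?thesis
    by blast
qed

section \<open>Complexifications\<close>

lemma real_form_real_hilbert_module:
  assumes sharp: "star_conj_automorphism sharp" and F: "real_form sharp act ip F"
  shows "real_hilbert_module (real_points sharp) F act ip"
proof
  note F' = F[unfolded real_form_def]
  show "subspace F"
    using F' by simp
  show "act x a \<in> F" if "x \<in> F" "a \<in> real_points sharp" for x a
    using F' that by simp
  show "ip x y \<in> real_points sharp" if "x \<in> F" "y \<in> F" for x y
    using F' that by simp
  show "\<exists>x\<in>F. (\<lambda>n. module_norm ip (s n - x)) \<longlonglongrightarrow> 0"
    if s: "\<And>n. s n \<in> F" "\<And>e. e > 0 \<Longrightarrow> \<exists>N. \<forall>m\<ge>N. \<forall>n\<ge>N. module_norm ip (s m - s n) < e" for s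
  proof -
    have "Cauchy s"
      using s(2) by (simp add: Cauchy_def module_norm_eq_norm dist_norm)
    then obtain l where "l \<in> F" "s \<longlonglongrightarrow> l"
      using F' s(1) unfolding complete_def by metis
    then show ?thesis
      by (auto simp: module_norm_eq_norm tendsto_norm_zero_iff LIM_zero_iff)
  qed
qed (auto simp: act_add_left act_add_right act_mult scaleR_scaleC act_scaleC_left
    act_scaleC_right ip_add_right ip_scaleC_right ip_act_right ip_star ip_positive ip_definite)

text \<open>Since a real form spans, the embedding is onto and the density condition is
  immediate.\<close>

lemma real_form_completion:
  assumes sharp: "star_conj_automorphism sharp" and F: "real_form sharp act ip F"
  shows "is_completion (cx_carrier F) (cx_act sharp act) (cx_ip ip) act ip
    (\<lambda>z. cx_re z + \<i> *\<^sub>C cx_im z)" (is "is_completion _ _ _ _ _ ?j")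
proof -
  have "z \<in> ?j ` cx_carrier F" for z
  proof -
    obtain x y where "x \<in> F" "y \<in> F" "z = x + \<i> *\<^sub>C y"
      using F unfolding real_form_def by meson
    then show ?thesis
      by (intro image_eqI[of _ _ "Cx x y"]) (auto simp: cx_carrier_def)
  qed
  then have "?j ` cx_carrier F = UNIV"
    by blast
  moreover have "?j (cx_act sharp act z a) = act (?j z) a" for z a
    using act_cartesian[of "cx_re z" "cx_im z" "sharp_re sharp a" "sharp_im sharp a"]
      sharp_decomposition(1)[OF sharp, of a] by (simp add: cx_act_def)
  moreover have "?j (c *\<^sub>C z) = c *\<^sub>C ?j z" for c z
    unfolding scaleC_cartesian by (simp add: scaleC_complexification_def)
  ultimately show ?thesis
    by (simp add: is_completion_def hilbert_module_axioms plus_complexification_def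
        ip_cartesian cx_ip_def scaleC_add_right)
qed

text \<open>The real form is the copy of \<open>F\<close> formed by the tensors
  \<open>x \<otimes> 1\<close>. The embedding preserves inner products, so completeness of
  \<open>F\<close> passes to the copy; density then gives the spanning property.\<close>

lemma completion_real_form:
  fixes j :: "'f::real_vector complexification \<Rightarrow> 'e"
  assumes sharp: "star_conj_automorphism sharp"
    and F: "real_hilbert_module (real_points sharp) F actF ipF"
    and j: "is_completion (cx_carrier F) (cx_act sharp actF) (cx_ip ipF) act ip j"
  shows "real_form sharp act ip ((\<lambda>x. j (Cx x 0)) ` F)"
proof -
  interpret F: real_hilbert_module "real_points sharp" F actF ipF
    by (rule F)
  note F_0 = subspace_0[OF F.subspace]
  define k where "k x = j (Cx x 0)" for x
  have X: "Cx x y \<in> cx_carrier F \<longleftrightarrow> x \<in> F \<and> y \<in> F" for x y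
    by (simp add: cx_carrier_def)
  have j_add: "j (z + w) = j z + j w" and j_scale: "j (c *\<^sub>C z) = c *\<^sub>C j z"
    and j_act: "j (cx_act sharp actF z a) = act (j z) a" and j_ip: "ip (j z) (j w) = cx_ip ipF z w"
    if "z \<in> cx_carrier F" "w \<in> cx_carrier F" for z w c a
    using j that by (auto simp: is_completion_def)
  have k_add: "k (x + y) = k x + k y" if "x \<in> F" "y \<in> F" for x y
    using j_add[of "Cx x 0" "Cx y 0"] that F_0
    by (simp add: k_def X plus_complexification_def)
  have k_scale: "k (r *\<^sub>R x) = r *\<^sub>R k x" if "x \<in> F" for x r
    using j_scale[of "Cx x 0" "Cx x 0" "complex_of_real r"] that F_0
    by (simp add: k_def X scaleC_complexification_def scaleR_scaleC)
  have k_diff: "k (x - y) = k x - k y" if "x \<in> F" "y \<in> F" for x y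
    using k_add[of "x - y" y] that subspace_diff[OF F.subspace] by simp
  have j_eq: "j (Cx x y) = k x + \<i> *\<^sub>C k y" if "x \<in> F" "y \<in> F" for x y
  proof -
    have "j (Cx x 0 + \<i> *\<^sub>C Cx y 0) = j (Cx x 0) + j (\<i> *\<^sub>C Cx y 0)"
      using that F_0 by (intro j_add) (simp_all add: X scaleC_complexification_def)
    moreover have "Cx x 0 + \<i> *\<^sub>C Cx y 0 = Cx x y"
      by (simp add: scaleC_complexification_def plus_complexification_def)
    ultimately show ?thesis
      using that F_0 j_scale[of "Cx y 0" "Cx y 0" \<i>] by (simp add: k_def X)
  qed
  have ip_0: "ipF x 0 = 0" "ipF 0 x = 0" if "x \<in> F" for x
  proof -
    show *: "ipF x 0 = 0"
      using F.ip_scaleR_right[OF that F_0, of 0] by simp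
    show "ipF 0 x = 0"
      using F.ip_star[OF that F_0] by (simp add: * star_zero)
  qed
  have k_ip: "ip (k x) (k y) = ipF x y" if "x \<in> F" "y \<in> F" for x y
    using j_ip[of "Cx x 0" "Cx y 0"] that F_0
    by (simp add: k_def X cx_ip_def ip_0 scaleC_simps)
  have k_norm: "norm (k x) = module_norm ipF x" if "x \<in> F" for x
    using that by (simp add: norm_eq module_norm_def k_ip)
  have k_act: "act (k x) a = k (actF x a)" if "x \<in> F" "a \<in> real_points sharp" for x a
  proof -
    have zero: "0 \<in> real_points sharp"
      by (simp add: real_points_def sharp_zero[OF sharp])
    have act_0: "actF v 0 = 0" "actF 0 a = 0" if "v \<in> F" for v
      using F.act_scaleR_right[OF that zero, of 0] F.act_scaleR_left[OF F_0 \<open>a \<in> _\<close>, of 0]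
      by simp_all
    show ?thesis
      using j_act[of "Cx x 0" "Cx x 0" a] that F_0
      by (simp add: k_def X cx_act_def sharp_parts_real[OF sharp] act_0)
  qed
  interpret real_valued_subspace act ip sharp "k ` F"
  proof unfold_locales
    show "star_conj_automorphism sharp"
      by (rule sharp)
    show "ip x y \<in> real_points sharp" if "x \<in> k ` F" "y \<in> k ` F" for x y
      using that by (auto simp: k_ip F.ip_closed)
    have "k 0 = 0"
      using k_scale[OF F_0, of 0] by simp
    then show "subspace (k ` F)"
      unfolding subspace_def using F_0 subspace_add[OF F.subspace] subspace_scale[OF F.subspace]
      by (auto simp: image_iff simp flip: k_add k_scale)
  qed
  have complete: "complete (k ` F)"
    unfolding complete_def
  proof (intro allI impI, elim conjE)
    fix g assume "\<forall>n. g n \<in> k ` F" and g: "Cauchy g"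
    then have "\<forall>n. \<exists>x. x \<in> F \<and> g n = k x"
      by blast
    then obtain s where s: "\<And>n. s n \<in> F" "\<And>n. g n = k (s n)"
      by metis
    \<comment> \<open>Completeness of \<open>F\<close> is stated through \<open>module_norm\<close>,
      so Cauchy sequences and limits are carried back and forth along \<open>k\<close>.\<close>
    have dist: "dist (g n) (k x) = module_norm ipF (s n - x)" if "x \<in> F" for n x
      using s that subspace_diff[OF F.subspace] by (simp add: dist_norm flip: k_diff k_norm)
    have "\<exists>x\<in>F. (\<lambda>n. module_norm ipF (s n - x)) \<longlonglongrightarrow> 0"
      using s(1) g by (intro F.complete) (auto simp: Cauchy_def s(2) simp flip: dist)
    then obtain x where x: "x \<in> F" "(\<lambda>n. module_norm ipF (s n - x)) \<longlonglongrightarrow> 0"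
      by blast
    then have "g \<longlonglongrightarrow> k x"
      by (subst tendsto_dist_iff) (simp add: dist)
    with x(1) show "\<exists>l\<in>k ` F. g \<longlonglongrightarrow> l"
      by blast
  qed
  have "j ` cx_carrier F = {x + \<i> *\<^sub>C y | x y. x \<in> k ` F \<and> y \<in> k ` F}" (is "_ = ?S")
  proof
    show "j ` cx_carrier F \<subseteq> ?S"
    proof
      fix z assume "z \<in> j ` cx_carrier F"
      then obtain w where "z = j w" "w \<in> cx_carrier F"
        by blast
      then show "z \<in> ?S"
        by (cases w) (auto simp: X j_eq)
    qed
    show "?S \<subseteq> j ` cx_carrier F"
      by (auto simp: X simp flip: j_eq)
  qed
  moreover have "closure (j ` cx_carrier F) = UNIV"
    using j by (simp add: is_completion_def)
  \<comment> \<open>The image of the complexification is dense by hypothesis and closed by the norm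
    estimates.\<close>
  ultimately have "?S = UNIV"
    using closed_cartesian[OF complete] by (simp add: closure_closed)
  then have "\<exists>x\<in>k ` F. \<exists>y\<in>k ` F. z = x + \<i> *\<^sub>C y" for z
  proof -
    have "z \<in> ?S"
      by (simp only: \<open>?S = UNIV\<close> UNIV_I)
    then show ?thesis
      by blast
  qed
  moreover have "act x a \<in> k ` F" if "x \<in> k ` F" "a \<in> real_points sharp" for x a
    using that by (auto simp: k_act F.act_closed)
  ultimately have "real_form sharp act ip (k ` F)"
    using complete by (intro real_formI)
  then show ?thesis
    by (simp add: k_def[abs_def])
qed

end

section \<open>Transport along isomorphisms and the equivalences\<close>

lemma sharp_conjugation_transport:
  assumes U: "hilbert_module_iso actH ipH act ip U" and C: "sharp_conjugation sharp ipH C"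
  shows "sharp_conjugation sharp ip (U \<circ> C \<circ> inv U)"
proof -
  have bij: "bij U" and add: "\<And>x y. U (x + y) = U x + U y" and scale: "\<And>c x. U (c *\<^sub>C x) = c *\<^sub>C U x"
    and norm: "\<And>x. norm (U x) = norm x" and ip_U: "\<And>x y. ip (U x) (U y) = ipH x y"
    using U by (auto simp: hilbert_module_iso_def)
  have C': "bounded_linear C" "\<And>c x. C (c *\<^sub>C x) = cnj c *\<^sub>C C x" "\<And>x. C (C x) = x"
    "\<And>x y. ipH (C x) (C y) = sharp (ipH x y)"
    using C by (auto simp: sharp_conjugation_def)
  have inv: "inv U (U x) = x" "U (inv U z) = z" for x z
    using bij by (simp_all add: bij_is_inj bij_is_surj surj_f_inv_f)
  have inv_add: "inv U (z + w) = inv U z + inv U w" and inv_scale: "inv U (c *\<^sub>C z) = c *\<^sub>C inv U z"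
    and inv_ip: "ipH (inv U z) (inv U w) = ip z w" and inv_norm: "norm (inv U z) = norm z" for z w c
    by (metis add inv, metis scale inv, metis ip_U inv, metis norm inv)
  have "bounded_linear U"
    by (rule bounded_linear_intro[where K = 1]) (simp_all add: add scale norm scaleR_scaleC)
  moreover have "bounded_linear (inv U)"
    by (rule bounded_linear_intro[where K = 1]) (simp_all add: inv_add inv_scale inv_norm scaleR_scaleC)
  ultimately have "bounded_linear (U \<circ> C \<circ> inv U)"
    unfolding o_def using C'(1) by (metis bounded_linear_compose)
  then show ?thesis
    using C' by (simp add: sharp_conjugation_def scale inv inv_scale inv_ip ip_U)
qed

text \<open>The real module becomes a real form of its completion, this form yields a conjugation
  there, and the isomorphism carries the conjugation over.\<close>

lemma complexified_imp_conjugation: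
  fixes act :: "'e::{complex_normed_vector, banach} \<Rightarrow> 'a::cstar_algebra \<Rightarrow> 'e"
  assumes sharp: "star_conj_automorphism sharp"
    and "is_complexified_real_module
      TYPE('f::real_vector) TYPE('h::{complex_normed_vector, banach}) sharp act ip"
  shows "\<exists>C. sharp_conjugation sharp ip C"
proof -
  obtain F :: "'f set" and actF ipF and actH :: "'h \<Rightarrow> 'a \<Rightarrow> 'h" and ipH j U
    where F: "real_hilbert_module (real_points sharp) F actF ipF"
      and j: "is_completion (cx_carrier F) (cx_act sharp actF) (cx_ip ipF) actH ipH j"
      and U: "hilbert_module_iso actH ipH act ip U"
    using assms(2) unfolding is_complexified_real_module_def by blast
  interpret H: hilbert_module actH ipH
    using j by (simp add: is_completion_def)
  show ?thesis
    using H.real_form_imp_conjugation[OF sharp H.completion_real_form[OF sharp F j]]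
      sharp_conjugation_transport[OF U] by blast
qed

text \<open>The real module is the fixed-point set of \<open>C\<close>, the completion is the given
  module itself, and the isomorphism is the identity; hence both types can be
  \<open>'e\<close>.\<close>

lemma (in hilbert_module) conjugation_imp_complexified:
  assumes sharp: "star_conj_automorphism sharp" and C: "sharp_conjugation sharp ip C"
  shows "is_complexified_real_module TYPE('e) TYPE('e) sharp act ip"
proof -
  note F = real_form_Fix(1)[OF sharp C]
  have "hilbert_module_iso act ip act ip id"
    by (simp add: hilbert_module_iso_def)
  then show ?thesis
    unfolding is_complexified_real_module_def
    using real_form_real_hilbert_module[OF sharp F] real_form_completion[OF sharp F] by blast
qed

text \<open>Assertion (2) depends on the types in which the real module and the completion are
  sought. Its strongest form, with both equal to \<open>'e\<close>, is equivalent to (1), and every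
  form, for arbitrary \<open>'f\<close> and \<open>'h\<close>, implies (1). The equivalence in the
  last conjunct states existence and uniqueness of the associated form at once.\<close>

theorem theorem3p8:
  fixes sharp :: "'a::cstar_algebra \<Rightarrow> 'a"
    and act :: "'e::{complex_normed_vector, banach} \<Rightarrow> 'a \<Rightarrow> 'e"
    and ip :: "'e \<Rightarrow> 'e \<Rightarrow> 'a"
  assumes "hilbert_module act ip"
    and "star_conj_automorphism sharp"
  shows "((\<exists>C. sharp_conjugation sharp ip C) \<longleftrightarrow>
            is_complexified_real_module TYPE('e) TYPE('e) sharp act ip) \<and>
         (is_complexified_real_module
            TYPE('f::real_vector) TYPE('h::{complex_normed_vector, banach}) sharp act ip \<longrightarrow>
          (\<exists>C. sharp_conjugation sharp ip C)) \<and>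
         ((\<exists>C. sharp_conjugation sharp ip C) \<longleftrightarrow> (\<exists>F. real_form sharp act ip F)) \<and>
         (\<forall>C. sharp_conjugation sharp ip C \<longrightarrow>
            (\<forall>F. real_form sharp act ip F \<and> associated_real_form C F \<longleftrightarrow> F = {x. C x = x}))"
proof -
  interpret hilbert_module act ip
    by (rule assms)
  note sharp = assms(2)
  have "(\<exists>C. sharp_conjugation sharp ip C) \<longleftrightarrow>
      is_complexified_real_module TYPE('e) TYPE('e) sharp act ip"
    using complexified_imp_conjugation[OF sharp] conjugation_imp_complexified[OF sharp] by blast
  moreover have "is_complexified_real_module TYPE('f) TYPE('h) sharp act ip \<longrightarrow>
      (\<exists>C. sharp_conjugation sharp ip C)"
    using complexified_imp_conjugation[OF sharp] by blast
  moreover have "(\<exists>C. sharp_conjugation sharp ip C) \<longleftrightarrow> (\<exists>F. real_form sharp act ip F)"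
    using real_form_Fix(1)[OF sharp] real_form_imp_conjugation[OF sharp] by blast
  moreover have "\<forall>C. sharp_conjugation sharp ip C \<longrightarrow>
      (\<forall>F. real_form sharp act ip F \<and> associated_real_form C F \<longleftrightarrow> F = {x. C x = x})"
    using real_form_Fix[OF sharp] associated_real_form_eq_Fix[OF sharp] by blast
  ultimately show ?thesis
    by (intro conjI)
qed

end
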